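(* Let $N \in B(\mathcal{H})$ be a normal operator with finite spectrum $\sigma(N)$, and let $(d_n)$ be the diagonal of $N$ with respect to the fixed orthonormal basis $\{e_n\}_{n=1}^\infty$, i.e. $d_n = \langle N e_n, e_n\rangle$. Then $(d_n) \in \mathrm{Lim}^1(\sigma(N))$ if and only if there exists a diagonal operator $N' = \operatorname{diag}(x_n)$ such that $\sigma(N') \subseteq \sigma(N)$ and $E(N-N')$ is trace-class, in which case $$\operatorname{Tr}\big(E(N-N')\big) = \sum_{n=1}^{\infty} (d_n - x_n).$$
   Context: $\mathcal{H}$ is a separable infinite-dimensional complex Hilbert space with a fixed orthonormal basis $\{e_n\}_{n=1}^\infty$. An operator is diagonal if it is diagonal with respect to this basis; $\operatorname{diag}(x_n)$ denotes the diagonal operator with $\operatorname{diag}(x_n) e_n = x_n e_n$. $E$ is the canonical trace-preserving conditional expectation of $B(\mathcal{H})$ onto the atomic masa of diagonal operators, i.e. $E(T) = \operatorname{diag}(\langle T e_n, e_n\rangle)$. For a finite set $X \subseteq \mathbb{C}$, $$\mathrm{Lim}^1(X) := \Big\{ (d_n) \in \ell^\infty : \sum_{n=1}^\infty \operatorname{dist}(d_n, X) < \infty \Big\}.$$ *)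

theory Defs
  imports "HOL-Analysis.Analysis"
begin

text \<open>The inner product is linear in its first argument.\<close>

class complex_hilbert = banach +
  fixes scaleC :: "complex \<Rightarrow> 'a \<Rightarrow> 'a" (infixr "*\<^sub>C" 75)
    and cinner :: "'a \<Rightarrow> 'a \<Rightarrow> complex"
  assumes scaleC_add_right: "c *\<^sub>C (x + y) = c *\<^sub>C x + c *\<^sub>C y"
    and scaleC_add_left: "(b + c) *\<^sub>C x = b *\<^sub>C x + c *\<^sub>C x"
    and scaleC_scaleC: "b *\<^sub>C (c *\<^sub>C x) = (b * c) *\<^sub>C x"
    and scaleC_one: "1 *\<^sub>C x = x"
    and scaleR_eq_scaleC: "r *\<^sub>R x = complex_of_real r *\<^sub>C x"
    and cinner_commute: "cinner x y = cnj (cinner y x)"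
    and cinner_add_left: "cinner (x + y) z = cinner x z + cinner y z"
    and cinner_scaleC_left: "cinner (c *\<^sub>C x) y = c * cinner x y"
    and cinner_self_norm: "cinner x x = complex_of_real ((norm x)\<^sup>2)"

definition bounded_op :: "('a::complex_hilbert \<Rightarrow> 'a) \<Rightarrow> bool" where
  "bounded_op T \<longleftrightarrow> bounded_linear T \<and> (\<forall>c x. T (c *\<^sub>C x) = c *\<^sub>C T x)"

definition adj :: "('a::complex_hilbert \<Rightarrow> 'a) \<Rightarrow> 'a \<Rightarrow> 'a" where
  "adj T = (THE S. bounded_op S \<and> (\<forall>x y. cinner (T x) y = cinner x (S y)))"

definition normal_op :: "('a::complex_hilbert \<Rightarrow> 'a) \<Rightarrow> bool" where
  "normal_op T \<longleftrightarrow> bounded_op T \<and> T \<circ> adj T = adj T \<circ> T"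

definition spectrum :: "('a::complex_hilbert \<Rightarrow> 'a) \<Rightarrow> complex set" where
  "spectrum T = {z. \<not> (\<exists>S. bounded_op S \<and>
     S \<circ> (\<lambda>v. T v - z *\<^sub>C v) = id \<and> (\<lambda>v. T v - z *\<^sub>C v) \<circ> S = id)}"

text \<open>Since the basis is indexed by \<^typ>\<open>nat\<close>, its existence makes the space separable
  and infinite-dimensional. Indices start at 0.\<close>

definition orthonormal_basis :: "(nat \<Rightarrow> 'a::complex_hilbert) \<Rightarrow> bool" where
  "orthonormal_basis e \<longleftrightarrow>
     (\<forall>m n. cinner (e m) (e n) = (if m = n then 1 else 0)) \<and>
     closure (module.span scaleC (range e)) = UNIV"

definition diagonal :: "(nat \<Rightarrow> 'a::complex_hilbert) \<Rightarrow> ('a \<Rightarrow> 'a) \<Rightarrow> nat \<Rightarrow> complex" where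
  "diagonal e T n = cinner (T (e n)) (e n)"

text \<open>For an orthonormal basis \<open>e\<close> and a bounded sequence \<open>x\<close> the series converges in norm
  everywhere; for unbounded \<open>x\<close> the value is meaningless.\<close>

definition diag_op :: "(nat \<Rightarrow> 'a::complex_hilbert) \<Rightarrow> (nat \<Rightarrow> complex) \<Rightarrow> 'a \<Rightarrow> 'a" where
  "diag_op e x v = (\<Sum>n. (x n * cinner v (e n)) *\<^sub>C e n)"

lemma diag_op_basis:
  assumes "orthonormal_basis e"
  shows "diag_op e x (e n) = x n *\<^sub>C e n"
proof -
  have z: "0 *\<^sub>C v = 0" for v :: 'a
    using scaleR_eq_scaleC[of 0 v] by simp
  have "diag_op e x (e n) = (\<Sum>k\<in>{n}. (x k * cinner (e n) (e k)) *\<^sub>C e k)"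
    unfolding diag_op_def using assms
    by (intro suminf_finite) (auto simp: orthonormal_basis_def z)
  then show ?thesis
    using assms by (simp add: orthonormal_basis_def)
qed

definition cond_exp :: "(nat \<Rightarrow> 'a::complex_hilbert) \<Rightarrow> ('a \<Rightarrow> 'a) \<Rightarrow> 'a \<Rightarrow> 'a" where
  "cond_exp e T = diag_op e (diagonal e T)"

definition positive_op :: "('a::complex_hilbert \<Rightarrow> 'a) \<Rightarrow> bool" where
  "positive_op T \<longleftrightarrow> bounded_op T \<and> (\<forall>v. cinner (T v) v \<in> \<real>\<^sub>\<ge>\<^sub>0)"

definition abs_op :: "('a::complex_hilbert \<Rightarrow> 'a) \<Rightarrow> 'a \<Rightarrow> 'a" where
  "abs_op T = (THE P. positive_op P \<and> P \<circ> P = adj T \<circ> T)"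

text \<open>Being trace-class, and the trace of a trace-class operator, do not depend on the
  orthonormal basis used to compute them. The sum in \<open>trace_class\<close> is the trace of
  \<open>abs_op T\<close>, whose terms are nonnegative reals.\<close>

definition trace_class :: "(nat \<Rightarrow> 'a::complex_hilbert) \<Rightarrow> ('a \<Rightarrow> 'a) \<Rightarrow> bool" where
  "trace_class e T \<longleftrightarrow> bounded_op T \<and> summable (diagonal e (abs_op T))"

definition op_trace :: "(nat \<Rightarrow> 'a::complex_hilbert) \<Rightarrow> ('a \<Rightarrow> 'a) \<Rightarrow> complex" where
  "op_trace e T = (\<Sum>n. diagonal e T n)"

text \<open>\<^const>\<open>infdist\<close> is the distance to a set only when the set is nonempty
  (it is 0 for the empty set); spectra of operators on nonzero spaces are nonempty.\<close>

definition Lim1 :: "complex set \<Rightarrow> (nat \<Rightarrow> complex) set" where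
  "Lim1 X = {d. bounded (range d) \<and> summable (\<lambda>n. infdist (d n) X)}"

end

(* For bounded y the operator diag(y) has absolute value diag(|y|), so it is trace-class exactly
   when y is absolutely summable. Since every x_n is an eigenvalue of diag(x), the condition
   spectrum (diag x) \<subseteq> spectrum N puts every x_n in spectrum N, and then infdist (d_n) is at most
   |d_n - x_n|. Conversely one chooses x_n to be a point of spectrum N nearest to d_n, which
   requires the spectrum to be nonempty (Liouville's theorem for the resolvent). *)
theory Submission
  imports Defs "HOL-Complex_Analysis.Complex_Analysis"
begin

section \<open>The inner product\<close>

interpretation scaleC: module "scaleC :: complex \<Rightarrow> 'a::complex_hilbert \<Rightarrow> 'a"
  by unfold_locales (simp_all add: scaleC_add_right scaleC_add_left scaleC_scaleC scaleC_one)

lemma cinner_add_right: "cinner x (y + z) = cinner x y + cinner x z"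
  by (metis cinner_commute cinner_add_left complex_cnj_add)

lemma cinner_scaleC_right: "cinner x (c *\<^sub>C y) = cnj c * cinner x y"
  by (metis cinner_commute cinner_scaleC_left complex_cnj_mult)

lemma cinner_zero_left [simp]: "cinner 0 x = 0"
  using cinner_add_left[of 0 0 x] by simp

lemma cinner_zero_right [simp]: "cinner x 0 = 0"
  using cinner_add_right[of x 0 0] by simp

lemma cinner_minus_left: "cinner (- x) y = - cinner x y"
  using cinner_add_left[of x "- x" y] by (simp add: eq_neg_iff_add_eq_0 add.commute)

lemma cinner_diff_left: "cinner (x - y) z = cinner x z - cinner y z"
  using cinner_add_left[of x "- y" z] by (simp add: cinner_minus_left)

lemma cinner_diff_right: "cinner x (y - z) = cinner x y - cinner x z"
  by (metis cinner_commute cinner_diff_left complex_cnj_diff)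

lemma cinner_sum_left: "cinner (sum f A) y = (\<Sum>i\<in>A. cinner (f i) y)"
  by (induction A rule: infinite_finite_induct) (simp_all add: cinner_add_left)

lemma cinner_sum_right: "cinner y (sum f A) = (\<Sum>i\<in>A. cinner y (f i))"
  by (induction A rule: infinite_finite_induct) (simp_all add: cinner_add_right)

lemma cinner_self_eq_zero: "cinner x x = 0 \<longleftrightarrow> x = 0"
  by (simp add: cinner_self_norm)

text \<open>The class gives homogeneity of the norm only for real scalars. The complex case is read
  off from \<open>cinner_self_norm\<close>, since a scalar leaves the two arguments as
  \<open>c\<close> and \<open>cnj c\<close>.\<close>

lemma norm_scaleC: "norm (c *\<^sub>C x) = cmod c * norm x"
proof -
  have "complex_of_real ((norm (c *\<^sub>C x))\<^sup>2) = c * cnj c * complex_of_real ((norm x)\<^sup>2)"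
    unfolding cinner_self_norm[symmetric] by (simp add: cinner_scaleC_left cinner_scaleC_right)
  also have "\<dots> = complex_of_real ((cmod c * norm x)\<^sup>2)"
    by (simp only: complex_norm_square[symmetric] of_real_mult[symmetric] power_mult_distrib)
  finally have "(norm (c *\<^sub>C x))\<^sup>2 = (cmod c * norm x)\<^sup>2"
    by (simp only: of_real_eq_iff)
  then show ?thesis
    by (rule power2_eq_imp_eq) simp_all
qed

lemma norm_diff_sq_complex:
  "complex_of_real ((norm (x - y))\<^sup>2) =
     cinner x x - cinner x y - cnj (cinner x y) + cinner y y"
  unfolding cinner_self_norm[symmetric]
  by (simp add: cinner_diff_left cinner_diff_right cinner_commute[of y x])

text \<open>With \<open>r = norm y\<close> and \<open>c = cinner x y\<close>, the vector
  \<open>r\<^sup>2 x - c y\<close> is \<open>r\<^sup>2\<close> times the component of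
  \<open>x\<close> orthogonal to \<open>y\<close>. Its squared norm is \<open>r\<^sup>2 * (r\<^sup>2
  * (norm x)\<^sup>2 - (cmod c)\<^sup>2)\<close>, which is nonnegative; the scaling avoids
  division.\<close>

lemma cinner_Cauchy_Schwarz: "cmod (cinner x y) \<le> norm x * norm y"
proof (cases "y = 0")
  case False
  define c where "c = cinner x y"
  define r where "r = norm y"
  have r: "r > 0" using False by (simp add: r_def)
  have "complex_of_real ((norm (complex_of_real (r\<^sup>2) *\<^sub>C x - c *\<^sub>C y))\<^sup>2) =
        complex_of_real (r\<^sup>2) * complex_of_real (r\<^sup>2) * complex_of_real ((norm x)\<^sup>2)
          - complex_of_real (r\<^sup>2) * (c * cnj c)"
    unfolding norm_diff_sq_complex cinner_scaleC_left cinner_scaleC_right c_def[symmetric]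
    by (simp add: cinner_self_norm r_def[symmetric] algebra_simps)
  also have "\<dots> = complex_of_real (r\<^sup>2 * (r\<^sup>2 * (norm x)\<^sup>2 - (cmod c)\<^sup>2))"
    unfolding complex_norm_square[symmetric] by (simp add: algebra_simps)
  finally have "0 \<le> r\<^sup>2 * (r\<^sup>2 * (norm x)\<^sup>2 - (cmod c)\<^sup>2)"
    by (metis of_real_eq_iff zero_le_power2)
  then have "(cmod c)\<^sup>2 \<le> (norm x * r)\<^sup>2"
    using r by (simp add: zero_le_mult_iff power_mult_distrib mult.commute)
  then show ?thesis
    using power2_le_imp_le[of "cmod c" "norm x * r"] r by (simp add: c_def r_def)
qed simp

lemma bounded_linear_cinner_left: "bounded_linear (\<lambda>x. cinner x y)"
  by (rule bounded_linear_intro[where K = "norm y"])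
    (simp_all add: cinner_add_left scaleR_eq_scaleC cinner_scaleC_left scaleR_conv_of_real
      cinner_Cauchy_Schwarz)

lemma bounded_linear_cinner_right: "bounded_linear (\<lambda>y. cinner x y)"
  by (rule bounded_linear_intro[where K = "norm x"])
    (simp_all add: cinner_add_right scaleR_eq_scaleC cinner_scaleC_right scaleR_conv_of_real
      cinner_Cauchy_Schwarz mult.commute[of _ "norm x"])

lemma bounded_linear_scaleC: "bounded_linear (\<lambda>x::'a::complex_hilbert. c *\<^sub>C x)"
  by (rule bounded_linear_intro[where K = "cmod c"])
    (simp_all add: scaleC_add_right scaleR_eq_scaleC scaleC_scaleC norm_scaleC mult.commute)

section \<open>Bounded operators and the spectrum\<close>

lemma bounded_op_imp_bounded_linear: "bounded_op T \<Longrightarrow> bounded_linear T"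
  by (simp add: bounded_op_def)

lemma bounded_op_scaleC: "bounded_op T \<Longrightarrow> T (c *\<^sub>C x) = c *\<^sub>C T x"
  by (simp add: bounded_op_def)

lemma bounded_op_id: "bounded_op id"
  by (simp add: bounded_op_def id_def bounded_linear_ident)

lemma bounded_op_compose: "bounded_op S \<Longrightarrow> bounded_op T \<Longrightarrow> bounded_op (S \<circ> T)"
  by (simp add: bounded_op_def bounded_linear_compose comp_def)

lemma bounded_op_diff: "bounded_op S \<Longrightarrow> bounded_op T \<Longrightarrow> bounded_op (\<lambda>v. S v - T v)"
  by (simp add: bounded_op_def bounded_linear_sub scaleC.scale_right_diff_distrib)

lemma bounded_op_const_scaleC: "bounded_op (\<lambda>v. c *\<^sub>C v)"
  by (simp add: bounded_op_def bounded_linear_scaleC scaleC_scaleC mult.commute)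

text \<open>A linear left inverse of T - z would have to send 0 = T v - z v to the nonzero vector
  v.\<close>

lemma eigenvalue_in_spectrum:
  assumes "v \<noteq> 0" and "T v = z *\<^sub>C v"
  shows "z \<in> spectrum T"
proof -
  have False if "bounded_op S" and "S \<circ> (\<lambda>v. T v - z *\<^sub>C v) = id" for S
  proof -
    have "v = S (T v - z *\<^sub>C v)"
      using that(2) by (metis comp_apply id_apply)
    also have "\<dots> = 0"
      using that(1) assms(2) by (simp add: bounded_op_def linear_simps)
    finally show False using assms(1) by simp
  qed
  then show ?thesis
    by (auto simp: spectrum_def)
qed

text \<open>If the spectrum were empty, the resolvent \<open>R z\<close> would exist for every z.
  Its coefficients \<open>cinner (R z u) v\<close> would be entire and tend to 0 at infinity, hence
  vanish by Liouville, and an invertible operator would kill the nonzero vector u.\<close>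

lemma spectrum_nonempty:
  fixes T :: "'a::complex_hilbert \<Rightarrow> 'a"
  assumes T: "bounded_op T" and u: "(u::'a) \<noteq> 0"
  shows "spectrum T \<noteq> {}"
proof
  assume "spectrum T = {}"
  then have "\<forall>z. \<exists>S. bounded_op S \<and> S \<circ> (\<lambda>v. T v - z *\<^sub>C v) = id \<and>
      (\<lambda>v. T v - z *\<^sub>C v) \<circ> S = id"
    by (auto simp: spectrum_def)
  then obtain R where R: "\<And>z. bounded_op (R z)"
    and R1: "\<And>z. R z \<circ> (\<lambda>v. T v - z *\<^sub>C v) = id"
    and R2: "\<And>z. (\<lambda>v. T v - z *\<^sub>C v) \<circ> R z = id"
    by metis
  have left: "R z (T v - z *\<^sub>C v) = v" for z v
    using R1[of z] by (metis comp_apply id_apply)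
  have right: "T (R z v) - z *\<^sub>C R z v = v" for z v
    using R2[of z] by (metis comp_apply id_apply)
  \<comment> \<open>The first resolvent identity: write v as (T - w) r - (z - w) r with r =
    \<open>R z v\<close>, and apply \<open>R w\<close>.\<close>
  have resolvent: "R z v - R w v = (z - w) *\<^sub>C R w (R z v)" for z w v
  proof -
    let ?r = "R z v"
    have "v = (T ?r - w *\<^sub>C ?r) - (z - w) *\<^sub>C ?r"
      using right[of z v] by (simp add: scaleC.scale_left_diff_distrib)
    then have "R w v = R w (T ?r - w *\<^sub>C ?r) - R w ((z - w) *\<^sub>C ?r)"
      using linear_diff[OF bounded_linear.linear[OF bounded_op_imp_bounded_linear[OF R[of w]]]]
      by metis
    then show ?thesis
      by (simp add: left bounded_op_scaleC[OF R])
  qed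
  have cont: "isCont (\<lambda>z. R z v) w" for v w
  proof -
    obtain M where M: "M > 0" "\<And>x. norm (R w x) \<le> norm x * M"
      using bounded_linear.pos_bounded[OF bounded_op_imp_bounded_linear[OF R]] by blast
    \<comment> \<open>Only \<open>R w\<close> has a known bound M. Once
      \<open>cmod (z - w) * M\<close> is at most 1/2, the resolvent identity lets the term in
      \<open>R z v\<close> be absorbed, giving \<open>norm (R z v)\<close> at most twice
      \<open>norm (R w v)\<close>. This local bound makes the difference O(|z - w|).\<close>
    have bd: "norm (R z v - R w v) \<le> 2 * M * norm (R w v) * cmod (z - w)"
      if "cmod (z - w) * M \<le> 1 / 2" for z
    proof -
      have eq: "norm (R z v - R w v) \<le> cmod (z - w) * (norm (R z v) * M)"
        unfolding resolvent norm_scaleC by (intro mult_left_mono M) simp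
      also have "\<dots> = (cmod (z - w) * M) * norm (R z v)" by simp
      also have "\<dots> \<le> 1 / 2 * norm (R z v)"
        by (intro mult_right_mono that) simp
      finally have "norm (R z v) \<le> 2 * norm (R w v)"
        using norm_triangle_ineq2[of "R z v" "R w v"] by simp
      then have "cmod (z - w) * (norm (R z v) * M) \<le> cmod (z - w) * ((2 * norm (R w v)) * M)"
        using M(1) by (intro mult_left_mono mult_right_mono) auto
      with eq show ?thesis by (simp add: algebra_simps)
    qed
    have "eventually (\<lambda>z. cmod (z - w) * M < 1 / 2) (at w)"
      by (rule order_tendstoD(2)[where y = 0]) (auto intro!: tendsto_eq_intros)
    then have "eventually
        (\<lambda>z. norm (R z v - R w v) \<le> 2 * M * norm (R w v) * cmod (z - w)) (at w)"
      by eventually_elim (rule bd, simp)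
    moreover have "((\<lambda>z. 2 * M * norm (R w v) * cmod (z - w)) \<longlongrightarrow> 0) (at w)"
      by (auto intro!: tendsto_eq_intros)
    ultimately have "((\<lambda>z. R z v - R w v) \<longlongrightarrow> 0) (at w)"
      by (rule Lim_null_comparison)
    then show ?thesis
      by (simp add: isCont_def LIM_zero_iff)
  qed
  \<comment> \<open>Away from w, the resolvent identity turns the difference quotient into
    \<open>cinner (R w (R z u)) v\<close>, so continuity of the resolvent at w supplies the
    limit.\<close>
  have deriv: "((\<lambda>z. cinner (R z u) v) has_field_derivative cinner (R w (R w u)) v) (at w)" for v w
  proof -
    have "((\<lambda>z. cinner (R w (R z u)) v) \<longlongrightarrow> cinner (R w (R w u)) v) (at w)"
      using cont[where v = u] unfolding isCont_def
      by (intro bounded_linear.tendsto[OF bounded_linear_cinner_left]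
          bounded_linear.tendsto[OF bounded_op_imp_bounded_linear[OF R]])
    moreover have "eventually (\<lambda>z. cinner (R w (R z u)) v =
        (cinner (R z u) v - cinner (R w u) v) / (z - w)) (at w)"
      unfolding eventually_at_filter cinner_diff_left[symmetric] resolvent
      by (simp add: cinner_scaleC_left)
    ultimately show ?thesis
      unfolding has_field_derivative_iff by (rule Lim_transform_eventually)
  qed
  obtain K where K: "K > 0" "\<And>x. norm (T x) \<le> norm x * K"
    using bounded_linear.pos_bounded[OF bounded_op_imp_bounded_linear[OF T]] by blast
  \<comment> \<open>This comes from z R(z)u = T R(z)u - u and the bound K on T.\<close>
  have decay: "norm (R z u) \<le> norm u / (cmod z - K)" if "cmod z > K" for z
  proof -
    have "cmod z * norm (R z u) = norm (z *\<^sub>C R z u)" by (simp add: norm_scaleC)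
    also have "\<dots> = norm (T (R z u) - u)"
      using right[of z u] by (metis add_diff_cancel_left' diff_add_cancel)
    also have "\<dots> \<le> norm (R z u) * K + norm u"
      by (meson K(2) add_mono norm_triangle_ineq4 order_refl order_trans)
    finally have "norm (R z u) * (cmod z - K) \<le> norm u" by (simp add: algebra_simps)
    then show ?thesis using that by (simp add: pos_le_divide_eq)
  qed
  have "cinner (R 0 u) v = 0" for v
  proof (rule Liouville_weak[where f = "\<lambda>z. cinner (R z u) v"])
    show "(\<lambda>z. cinner (R z u) v) holomorphic_on UNIV"
      using deriv by (auto simp: holomorphic_on_open)
    have "eventually (\<lambda>z. cmod z > K) at_infinity"
      using filterlim_norm_at_top unfolding filterlim_at_top_dense by blast
    then have "eventually (\<lambda>z. norm (R z u) \<le> norm u / (cmod z - K)) at_infinity"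
      by eventually_elim (rule decay)
    moreover have "((\<lambda>z. norm u / (cmod z - K)) \<longlongrightarrow> 0) at_infinity"
    proof (rule tendsto_divide_0[OF tendsto_const])
      show "filterlim (\<lambda>z. cmod z - K) at_infinity at_infinity"
        by (intro filterlim_at_top_imp_at_infinity
            filterlim_tendsto_add_at_top[OF tendsto_const[of "- K"] filterlim_norm_at_top, simplified])
    qed
    ultimately have "((\<lambda>z. R z u) \<longlongrightarrow> 0) at_infinity"
      by (rule Lim_null_comparison)
    then show "((\<lambda>z. cinner (R z u) v) \<longlongrightarrow> 0) at_infinity"
      using bounded_linear.tendsto[OF bounded_linear_cinner_left] by fastforce
  qed
  \<comment> \<open>Take v to be \<open>R 0 u\<close> itself. At z = 0 the right-inverse identity
    then reads \<open>T 0 = u\<close>.\<close>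
  then have "R 0 u = 0"
    using cinner_self_eq_zero by blast
  then have "T 0 = u"
    using right[of 0 u] by simp
  then show False
    using u linear_0[OF bounded_linear.linear[OF bounded_op_imp_bounded_linear[OF T]]] by simp
qed

section \<open>Diagonal operators\<close>

lemma basis_orthonormal:
  "orthonormal_basis e \<Longrightarrow> cinner (e m) (e n) = (if m = n then 1 else 0)"
  by (simp add: orthonormal_basis_def)

lemma basis_nonzero: "orthonormal_basis e \<Longrightarrow> e n \<noteq> 0"
  using basis_orthonormal[of e n n] by auto

text \<open>The set where two bounded operators agree is closed and, by linearity, contains the span
  of the basis, which is dense.\<close>

lemma bounded_op_eqI:
  assumes e: "orthonormal_basis e" and S: "bounded_op S" and T: "bounded_op T"
    and eq: "\<And>n. S (e n) = T (e n)"
  shows "S = T"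
proof -
  note S' = bounded_op_imp_bounded_linear[OF S] and T' = bounded_op_imp_bounded_linear[OF T]
  have "S v = T v" if "v \<in> scaleC.span (range e)" for v
    using that
  proof (induction rule: scaleC.span_induct_alt)
    case base
    show ?case by (simp add: linear_simps S' T')
  next
    case (step c x y)
    then show ?case
      using eq by (auto simp: linear_simps S' T' bounded_op_scaleC[OF S] bounded_op_scaleC[OF T])
  qed
  then have "scaleC.span (range e) \<subseteq> {v. S v = T v}" by auto
  moreover have "closed {v. S v = T v}"
    by (intro closed_Collect_eq linear_continuous_on S' T')
  ultimately have "closure (scaleC.span (range e)) \<subseteq> {v. S v = T v}"
    by (rule closure_minimal)
  then show ?thesis
    using e by (auto simp: orthonormal_basis_def)
qed

section \<open>Orthonormal sums: Pythagoras, Bessel's inequality and norm convergence\<close>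

lemma norm_sq_sum_basis:
  assumes "orthonormal_basis e" and "finite A"
  shows "(norm (\<Sum>k\<in>A. c k *\<^sub>C e k))\<^sup>2 = (\<Sum>k\<in>A. (cmod (c k))\<^sup>2)"
proof -
  have "complex_of_real ((norm (\<Sum>k\<in>A. c k *\<^sub>C e k))\<^sup>2) =
      (\<Sum>k\<in>A. \<Sum>j\<in>A. c j * cnj (c k) * cinner (e j) (e k))"
    unfolding cinner_self_norm[symmetric]
    by (simp add: cinner_sum_left cinner_sum_right cinner_scaleC_left cinner_scaleC_right
        sum_distrib_left mult_ac)
  also have "\<dots> = (\<Sum>k\<in>A. \<Sum>j\<in>A. if j = k then c j * cnj (c k) else 0)"
    by (intro sum.cong refl) (simp add: basis_orthonormal[OF assms(1)])
  also have "\<dots> = complex_of_real (\<Sum>k\<in>A. (cmod (c k))\<^sup>2)"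
    using assms(2) unfolding of_real_sum complex_norm_square by simp
  finally show ?thesis
    by (simp only: of_real_eq_iff)
qed

text \<open>For the projection p of v onto the span of the chosen basis vectors, both
  \<open>cinner p p\<close> and \<open>cinner v p\<close> equal the sum s of the squared
  coefficients. Hence \<open>norm (v - p)\<close> has square
  \<open>(norm v)\<^sup>2 - s\<close>.\<close>

lemma bessel_inequality:
  assumes e: "orthonormal_basis e" and A: "finite A"
  shows "(\<Sum>k\<in>A. (cmod (cinner v (e k)))\<^sup>2) \<le> (norm v)\<^sup>2"
proof -
  let ?p = "\<Sum>k\<in>A. cinner v (e k) *\<^sub>C e k"
  let ?s = "\<Sum>k\<in>A. (cmod (cinner v (e k)))\<^sup>2"
  have p: "cinner ?p ?p = complex_of_real ?s"
    unfolding cinner_self_norm norm_sq_sum_basis[OF e A] ..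
  have vp: "cinner v ?p = complex_of_real ?s"
    unfolding of_real_sum complex_norm_square
    by (simp add: cinner_sum_right cinner_scaleC_right mult.commute)
  have "complex_of_real ((norm (v - ?p))\<^sup>2) = complex_of_real ((norm v)\<^sup>2 - ?s)"
    unfolding norm_diff_sq_complex p vp by (simp add: cinner_self_norm)
  then have "(norm v)\<^sup>2 - ?s = (norm (v - ?p))\<^sup>2"
    by (simp only: of_real_eq_iff)
  then show ?thesis
    by (smt (verit) zero_le_power2)
qed

text \<open>By Pythagoras the squared norm of a block of the vector series is the same block of the
  scalar series, so the Cauchy criterion transfers and completeness gives the limit.\<close>

lemma summable_basis:
  assumes e: "orthonormal_basis e" and c: "summable (\<lambda>k. (cmod (c k))\<^sup>2)"
  shows "summable (\<lambda>k. c k *\<^sub>C e k)"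
  unfolding summable_Cauchy
proof (intro allI impI)
  fix r :: real assume r: "r > 0"
  then obtain N where N: "\<And>m n. m \<ge> N \<Longrightarrow> norm (\<Sum>k=m..<n. (cmod (c k))\<^sup>2) < r\<^sup>2"
    using c unfolding summable_Cauchy by (metis zero_less_power)
  have "norm (\<Sum>k=m..<n. c k *\<^sub>C e k) < r" if "m \<ge> N" for m n
  proof -
    have "(norm (\<Sum>k=m..<n. c k *\<^sub>C e k))\<^sup>2 < r\<^sup>2"
      using N[OF that, of n] unfolding norm_sq_sum_basis[OF e finite_atLeastLessThan]
      by simp
    then show ?thesis using r by (simp add: power_less_imp_less_base)
  qed
  then show "\<exists>N. \<forall>m\<ge>N. \<forall>n. norm (\<Sum>k=m..<n. c k *\<^sub>C e k) < r" by blast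
qed

section \<open>Convergence, boundedness, adjoints and products of diagonal operators\<close>

lemma sum_diag_coeffs_le:
  assumes e: "orthonormal_basis e" and C: "\<And>n. cmod (x n) \<le> C" and A: "finite A"
  shows "(\<Sum>k\<in>A. (cmod (x k * cinner v (e k)))\<^sup>2) \<le> (C * norm v)\<^sup>2"
proof -
  have "(\<Sum>k\<in>A. (cmod (x k * cinner v (e k)))\<^sup>2) \<le> (\<Sum>k\<in>A. C\<^sup>2 * (cmod (cinner v (e k)))\<^sup>2)"
    by (intro sum_mono) (simp add: norm_mult power_mult_distrib mult_right_mono power_mono C)
  also have "\<dots> \<le> C\<^sup>2 * (norm v)\<^sup>2"
    unfolding sum_distrib_left[symmetric] by (intro mult_left_mono bessel_inequality e A) simp
  finally show ?thesis by (simp add: power_mult_distrib)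
qed

text \<open>Bessel makes the coefficients square-summable. This shows that the \<open>suminf\<close>
  in \<open>diag_op\<close> is a genuine limit, on which all later termwise arguments rest.\<close>

lemma diag_op_sums:
  assumes e: "orthonormal_basis e" and x: "bounded (range x)"
  shows "(\<lambda>n. (x n * cinner v (e n)) *\<^sub>C e n) sums diag_op e x v"
proof -
  obtain C where C: "\<And>n. cmod (x n) \<le> C"
    using x by (auto simp: bounded_iff)
  have "summable (\<lambda>k. (cmod (x k * cinner v (e k)))\<^sup>2)"
    by (rule summableI_nonneg_bounded) (auto intro: sum_diag_coeffs_le[OF e C])
  then show ?thesis
    unfolding diag_op_def by (intro summable_sums summable_basis e)
qed

text \<open>Linearity follows from uniqueness of sums. The norm bound holds for every partial sum,
  with a constant independent of its length, and passes to the limit.\<close>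

lemma bounded_op_diag_op:
  assumes e: "orthonormal_basis e" and x: "bounded (range x)"
  shows "bounded_op (diag_op e x)"
proof -
  note sums = diag_op_sums[OF assms]
  obtain C where C: "\<And>n. cmod (x n) \<le> C"
    using x by (auto simp: bounded_iff)
  then have C0: "C \<ge> 0"
    using norm_ge_zero order_trans by blast
  have add: "diag_op e x (v + w) = diag_op e x v + diag_op e x w" for v w
    using sums_add[OF sums[where v = v] sums[where v = w]]
    by (intro sums_unique2[OF sums]) (simp add: cinner_add_left distrib_left scaleC_add_left)
  have scale: "diag_op e x (c *\<^sub>C v) = c *\<^sub>C diag_op e x v" for c v
    using bounded_linear.sums[OF bounded_linear_scaleC[of c] sums[where v = v]]
    by (intro sums_unique2[OF sums]) (simp add: cinner_scaleC_left scaleC_scaleC mult_ac)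
  have bound: "norm (diag_op e x v) \<le> norm v * C" for v
  proof (rule Lim_bounded)
    show "(\<lambda>n. norm (\<Sum>k<n. (x k * cinner v (e k)) *\<^sub>C e k)) \<longlonglongrightarrow> norm (diag_op e x v)"
      using sums[where v = v] unfolding sums_def by (rule tendsto_norm)
    have "norm (\<Sum>k<n. (x k * cinner v (e k)) *\<^sub>C e k) \<le> C * norm v" for n
    proof (rule power2_le_imp_le)
      show "(norm (\<Sum>k<n. (x k * cinner v (e k)) *\<^sub>C e k))\<^sup>2 \<le> (C * norm v)\<^sup>2"
        unfolding norm_sq_sum_basis[OF e finite_lessThan]
        by (rule sum_diag_coeffs_le[OF e C finite_lessThan])
    qed (simp add: C0)
    then show "\<forall>n\<ge>0. norm (\<Sum>k<n. (x k * cinner v (e k)) *\<^sub>C e k) \<le> norm v * C"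
      by (simp add: mult.commute)
  qed
  have "bounded_linear (diag_op e x)"
    by (rule bounded_linear_intro[OF add _ bound]) (simp add: scaleR_eq_scaleC scale)
  then show ?thesis
    by (simp add: bounded_op_def scale)
qed

lemma bounded_op_scale_basis_eq_diag_op:
  assumes "orthonormal_basis e" "bounded (range x)" "bounded_op T" "\<And>n. T (e n) = x n *\<^sub>C e n"
  shows "T = diag_op e x"
  using assms by (intro bounded_op_eqI) (auto simp: bounded_op_diag_op diag_op_basis)

text \<open>Since \<open>adj\<close> is a definite description, exhibiting a candidate is not
  enough. Two candidates agree because their difference at any y is orthogonal to every vector, in
  particular to itself.\<close>

lemma adj_eqI:
  assumes S: "bounded_op S" and adj: "\<And>x y. cinner (T x) y = cinner x (S y)"
  shows "adj T = S"
  unfolding adj_def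
proof (rule the_equality)
  fix S' assume S': "bounded_op S' \<and> (\<forall>x y. cinner (T x) y = cinner x (S' y))"
  have "cinner (S' y - S y) (S' y - S y) = 0" for y
    using S' adj by (metis cinner_diff_right diff_self)
  then show "S' = S"
    by (auto simp: cinner_self_eq_zero)
qed (use assms in auto)

text \<open>Both sides of the adjoint relation expand into the series with terms
  \<open>x n * cinner u (e n) * cinner (e n) v\<close>; the antilinear second argument undoes the
  conjugate on the entries.\<close>

lemma adj_diag_op:
  assumes e: "orthonormal_basis e" and x: "bounded (range x)"
  shows "adj (diag_op e x) = diag_op e (\<lambda>n. cnj (x n))"
proof (rule adj_eqI)
  have x': "bounded (range (\<lambda>n. cnj (x n)))"
    using x by (simp add: bounded_iff)
  show "bounded_op (diag_op e (\<lambda>n. cnj (x n)))"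
    by (rule bounded_op_diag_op[OF e x'])
  fix u v
  have "(\<lambda>n. x n * cinner u (e n) * cinner (e n) v) sums cinner (diag_op e x u) v"
    using bounded_linear.sums[OF bounded_linear_cinner_left diag_op_sums[OF e x]]
    by (simp add: cinner_scaleC_left)
  moreover have "(\<lambda>n. cinner u ((cnj (x n) * cinner v (e n)) *\<^sub>C e n))
      sums cinner u (diag_op e (\<lambda>n. cnj (x n)) v)"
    using bounded_linear.sums[OF bounded_linear_cinner_right diag_op_sums[OF e x']] .
  moreover have "cinner u ((cnj (x n) * cinner v (e n)) *\<^sub>C e n) =
      x n * cinner u (e n) * cinner (e n) v" for n
    using cinner_commute[of "e n" v] by (simp add: cinner_scaleC_right mult_ac)
  ultimately show "cinner (diag_op e x u) v = cinner u (diag_op e (\<lambda>n. cnj (x n)) v)"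
    by (simp add: sums_unique2)
qed

lemma diag_op_compose:
  assumes e: "orthonormal_basis e" and x: "bounded (range x)" and y: "bounded (range y)"
  shows "diag_op e x \<circ> diag_op e y = diag_op e (\<lambda>n. x n * y n)"
proof (rule bounded_op_scale_basis_eq_diag_op[OF e])
  show "bounded (range (\<lambda>n. x n * y n))"
  proof -
    obtain B C where "\<And>n. cmod (x n) \<le> B" "\<And>n. cmod (y n) \<le> C"
      using x y by (auto simp: bounded_iff)
    then have "cmod (x n * y n) \<le> B * C" for n
      unfolding norm_mult by (intro mult_mono) (auto intro: order_trans[OF norm_ge_zero])
    then show ?thesis by (auto simp: bounded_iff)
  qed
  show "bounded_op (diag_op e x \<circ> diag_op e y)"
    by (intro bounded_op_compose bounded_op_diag_op e x y)
  show "(diag_op e x \<circ> diag_op e y) (e n) = (x n * y n) *\<^sub>C e n" for n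
    by (simp add: diag_op_basis[OF e] bounded_op_scaleC[OF bounded_op_diag_op[OF e x]]
        scaleC_scaleC mult.commute)
qed

section \<open>Positive diagonal operators and the absolute value\<close>

lemma positive_op_diag_op:
  assumes e: "orthonormal_basis e" and x: "bounded (range x)" and pos: "\<And>n. x n \<in> \<real>\<^sub>\<ge>\<^sub>0"
  shows "positive_op (diag_op e x)"
  unfolding positive_op_def
proof (intro conjI allI bounded_op_diag_op e x)
  fix v
  have "(\<lambda>n. cinner ((x n * cinner v (e n)) *\<^sub>C e n) v) sums cinner (diag_op e x v) v"
    using bounded_linear.sums[OF bounded_linear_cinner_left diag_op_sums[OF e x]] .
  then have lim: "(\<lambda>n. \<Sum>k<n. cinner ((x k * cinner v (e k)) *\<^sub>C e k) v)
      \<longlonglongrightarrow> cinner (diag_op e x v) v"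
    by (simp only: sums_def)
  have "cinner ((x k * cinner v (e k)) *\<^sub>C e k) v =
      x k * complex_of_real ((cmod (cinner v (e k)))\<^sup>2)" for k
    using cinner_commute[of "e k" v] unfolding complex_norm_square by (simp add: cinner_scaleC_left)
  \<comment> \<open>Each term is a nonnegative entry times a squared modulus. The nonnegative reals
    are closed in the complex plane, so the limit of the partial sums stays among them.\<close>
  then have "(\<Sum>k<n. cinner ((x k * cinner v (e k)) *\<^sub>C e k) v) \<in> \<real>\<^sub>\<ge>\<^sub>0" for n
    using pos by (induction n) (auto intro!: nonneg_Reals_add_I nonneg_Reals_mult_I)
  then show "cinner (diag_op e x v) v \<in> \<real>\<^sub>\<ge>\<^sub>0"
    by (intro closed_sequentially[OF closed_nonneg_Reals_complex _ lim]) auto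
qed

text \<open>If \<open>P\<^sup>2 v = a\<^sup>2 v\<close>, then \<open>w = P v - a v\<close> satisfies \<open>P w = - a w\<close>, which contradicts positivity
  when \<open>a > 0\<close> and \<open>w \<noteq> 0\<close>. When \<open>a = 0\<close>, the quadratic form of \<open>P\<close> at \<open>P v + t v\<close> is
  \<open>t \<parallel>P v\<parallel>\<^sup>2 + t\<^sup>2 \<langle>P v, v\<rangle>\<close>, which is negative for small \<open>t < 0\<close> unless \<open>P v = 0\<close>.\<close>

lemma positive_sqrt_eigenvector:
  assumes P: "positive_op P" and a: "a \<ge> 0"
    and sq: "P (P v) = complex_of_real (a\<^sup>2) *\<^sub>C v"
  shows "P v = complex_of_real a *\<^sub>C v"
proof -
  have P': "bounded_op P" and pos: "\<And>u. cinner (P u) u \<in> \<real>\<^sub>\<ge>\<^sub>0"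
    using P by (auto simp: positive_op_def)
  note lin = bounded_op_imp_bounded_linear[OF P']
  show ?thesis
  proof (cases "a = 0")
    case False
    define w where "w = P v - complex_of_real a *\<^sub>C v"
    have "P w = - (complex_of_real a *\<^sub>C w)"
      by (simp add: w_def linear_simps lin bounded_op_scaleC[OF P'] sq
          scaleC.scale_right_diff_distrib scaleC_scaleC power2_eq_square)
    then have "cinner (P w) w = complex_of_real (- (a * (norm w)\<^sup>2))"
      by (simp add: cinner_minus_left cinner_scaleC_left cinner_self_norm)
    then have "0 \<le> - (a * (norm w)\<^sup>2)"
      using pos[of w] by (simp only: nonneg_Reals_of_real_iff)
    then have "w = 0"
      using a False by (simp add: mult_le_0_iff)
    then show ?thesis by (simp add: w_def)
  next
    case True
    then have PP: "P (P v) = 0" using sq by simp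
    obtain b where b: "b \<ge> 0" "cinner (P v) v = complex_of_real b"
      using pos[of v] by (auto elim: nonneg_Reals_cases)
    have ge: "0 \<le> t * (norm (P v))\<^sup>2 + t\<^sup>2 * b" for t :: real
    proof -
      let ?u = "P v + complex_of_real t *\<^sub>C v"
      have "P ?u = complex_of_real t *\<^sub>C P v"
        by (simp add: linear_simps lin bounded_op_scaleC[OF P'] PP)
      then have "cinner (P ?u) ?u = complex_of_real (t * (norm (P v))\<^sup>2 + t\<^sup>2 * b)"
        by (simp add: cinner_scaleC_left cinner_scaleC_right cinner_add_right cinner_self_norm b(2)
            power2_eq_square algebra_simps)
      then show ?thesis
        using pos[of ?u] by (simp only: nonneg_Reals_of_real_iff)
    qed
    define s where "s = (norm (P v))\<^sup>2"
    have "s = 0"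
    proof (rule ccontr)
      assume "s \<noteq> 0"
      then have s: "s > 0" by (simp add: s_def)
      \<comment> \<open>The form at -t is t (t b - s). This t makes the bracket equal to -t, so the
        value is negative; the denominator b + 1 stays positive even when b = 0.\<close>
      define t where "t = s / (b + 1)"
      have t: "t > 0" "t * (b + 1) = s" using s b(1) by (auto simp: t_def)
      have "0 \<le> t * (t * b - s)"
        using ge[of "- t"] by (simp add: s_def power2_eq_square algebra_simps)
      moreover have "t * b - s = - t" using t(2) by (simp add: algebra_simps)
      ultimately show False using t(1) mult_pos_pos[OF t(1) t(1)] by simp
    qed
    then show ?thesis using True by (simp add: s_def)
  qed
qed

text \<open>Here T* T is diagonal with entries |x_n|^2, so each basis vector is an eigenvector of P
  P for any positive root P. Hence \<open>positive_sqrt_eigenvector\<close> fixes P on the basis,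
  which settles uniqueness in the definite description.\<close>

lemma abs_op_diag_op:
  assumes e: "orthonormal_basis e" and x: "bounded (range x)"
  shows "abs_op (diag_op e x) = diag_op e (\<lambda>n. complex_of_real (cmod (x n)))"
proof -
  let ?a = "\<lambda>n. complex_of_real (cmod (x n))"
  have a: "bounded (range ?a)" and x': "bounded (range (\<lambda>n. cnj (x n)))"
    using x by (simp_all add: bounded_iff)
  have T: "adj (diag_op e x) \<circ> diag_op e x = diag_op e (\<lambda>n. complex_of_real ((cmod (x n))\<^sup>2))"
    unfolding adj_diag_op[OF e x] diag_op_compose[OF e x' x] complex_norm_square
    by (simp add: mult.commute)
  show ?thesis
    unfolding abs_op_def T
  proof (rule the_equality)
    show "positive_op (diag_op e ?a) \<and>
        diag_op e ?a \<circ> diag_op e ?a = diag_op e (\<lambda>n. complex_of_real ((cmod (x n))\<^sup>2))"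
      by (simp add: positive_op_diag_op[OF e a] diag_op_compose[OF e a a] power2_eq_square)
  next
    fix P assume P: "positive_op P \<and> P \<circ> P = diag_op e (\<lambda>n. complex_of_real ((cmod (x n))\<^sup>2))"
    have "P (P (e n)) = complex_of_real ((cmod (x n))\<^sup>2) *\<^sub>C e n" for n
      using P diag_op_basis[OF e] by (metis comp_apply)
    then have "P (e n) = ?a n *\<^sub>C e n" for n
      using P by (auto intro: positive_sqrt_eigenvector[OF _ norm_ge_zero])
    then show "P = diag_op e ?a"
      using P by (intro bounded_op_scale_basis_eq_diag_op[OF e a]) (auto simp: positive_op_def)
  qed
qed

section \<open>Diagonals and trace-class membership of diagonal operators\<close>

lemma diagonal_diag_op: "orthonormal_basis e \<Longrightarrow> diagonal e (diag_op e x) = x"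
  by (simp add: fun_eq_iff diagonal_def diag_op_basis cinner_scaleC_left basis_orthonormal)

lemma trace_class_diag_op_iff:
  assumes "orthonormal_basis e" and "bounded (range x)"
  shows "trace_class e (diag_op e x) \<longleftrightarrow> summable (\<lambda>n. cmod (x n))"
  using assms
  by (simp add: trace_class_def bounded_op_diag_op abs_op_diag_op diagonal_diag_op
      summable_complex_of_real)

section \<open>Spectra of diagonal operators\<close>

lemma entry_in_spectrum_diag_op: "orthonormal_basis e \<Longrightarrow> x n \<in> spectrum (diag_op e x)"
  by (rule eigenvalue_in_spectrum[of "e n"]) (simp_all add: basis_nonzero diag_op_basis)

text \<open>Off the closure, |x_n - z| is bounded below by some r > 0, so the reciprocals are
  bounded by 1/r and define a bounded two-sided inverse of diag(x) - z.\<close>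

lemma spectrum_diag_op_subset_closure:
  assumes e: "orthonormal_basis e" and x: "bounded (range x)"
  shows "spectrum (diag_op e x) \<subseteq> closure (range x)"
proof
  fix z assume z: "z \<in> spectrum (diag_op e x)"
  show "z \<in> closure (range x)"
  proof (rule ccontr)
    assume "z \<notin> closure (range x)"
    then obtain r where r: "r > 0" "\<And>n. r \<le> cmod (x n - z)"
      by (auto simp: closure_approachable dist_norm not_less)
    let ?y = "\<lambda>n. inverse (x n - z)"
    have y: "bounded (range ?y)"
      using r by (auto simp: bounded_iff norm_inverse intro!: exI[of _ "inverse r"] le_imp_inverse_le)
    have xz: "x n - z \<noteq> 0" for n using r(1) r(2)[of n] by auto
    have xz_bounded: "bounded (range (\<lambda>n. x n - z))"
      using bounded_minus_comp[of x UNIV "\<lambda>_. z"] x by auto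
    have shift: "(\<lambda>v. diag_op e x v - z *\<^sub>C v) = diag_op e (\<lambda>n. x n - z)"
      by (intro bounded_op_scale_basis_eq_diag_op e xz_bounded bounded_op_diff
          bounded_op_diag_op x bounded_op_const_scaleC)
        (simp add: diag_op_basis[OF e] scaleC.scale_left_diff_distrib)
    have one: "diag_op e (\<lambda>n. 1) = id"
      by (rule bounded_op_scale_basis_eq_diag_op[symmetric, OF e])
        (simp_all add: bounded_op_id scaleC_one)
    have "diag_op e ?y \<circ> diag_op e (\<lambda>n. x n - z) = id"
      "diag_op e (\<lambda>n. x n - z) \<circ> diag_op e ?y = id"
      unfolding diag_op_compose[OF e y xz_bounded] diag_op_compose[OF e xz_bounded y]
      using xz one by simp_all
    then show False
      using z bounded_op_diag_op[OF e y] by (auto simp: spectrum_def shift)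
  qed
qed

lemma bounded_diagonal:
  assumes e: "orthonormal_basis e" and T: "bounded_op T"
  shows "bounded (range (diagonal e T))"
proof -
  obtain K where K: "\<And>v. norm (T v) \<le> norm v * K"
    using bounded_linear.bounded[OF bounded_op_imp_bounded_linear[OF T]] by blast
  have n: "norm (e n) = 1" for n
  proof -
    have "complex_of_real ((norm (e n))\<^sup>2) = 1"
      unfolding cinner_self_norm[symmetric] by (simp add: basis_orthonormal[OF e])
    then have "(norm (e n))\<^sup>2 = 1"
      by (simp only: of_real_eq_1_iff)
    then show ?thesis
      using norm_ge_zero[of "e n"] by (auto simp: power2_eq_1_iff simp del: norm_ge_zero)
  qed
  have "cmod (diagonal e T n) \<le> K" for n
    using cinner_Cauchy_Schwarz[of "T (e n)" "e n"] K[of "e n"] by (simp add: diagonal_def n)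
  then show ?thesis by (auto simp: bounded_iff)
qed


section \<open>The equivalence and the trace formula\<close>

theorem proposition3p5:
  fixes e :: "nat \<Rightarrow> 'a::complex_hilbert" and N :: "'a \<Rightarrow> 'a" and d :: "nat \<Rightarrow> complex"
  assumes "orthonormal_basis e"
    and "normal_op N"
    and "finite (spectrum N)"
    and "\<And>n. d n = cinner (N (e n)) (e n)"
  shows "(d \<in> Lim1 (spectrum N) \<longleftrightarrow>
           (\<exists>x. bounded (range x) \<and> spectrum (diag_op e x) \<subseteq> spectrum N \<and>
                trace_class e (cond_exp e (\<lambda>v. N v - diag_op e x v)))) \<and>
         (\<forall>x. bounded (range x) \<and> spectrum (diag_op e x) \<subseteq> spectrum N \<and>
              trace_class e (cond_exp e (\<lambda>v. N v - diag_op e x v)) \<longrightarrow>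
              (\<lambda>n. d n - x n) sums op_trace e (cond_exp e (\<lambda>v. N v - diag_op e x v)))"
proof -
  note e = assms(1)
  have N: "bounded_op N"
    using assms(2) by (simp add: normal_op_def)
  have d: "d = diagonal e N"
    using assms(4) by (auto simp: diagonal_def)
  have bd: "bounded (range d)"
    unfolding d by (rule bounded_diagonal[OF e N])
  \<comment> \<open>Both N and diag(x) enter the expectation only through their diagonals, which
    reduces every claim to the scalar sequence \<open>d n - x n\<close>.\<close>
  have ce: "cond_exp e (\<lambda>v. N v - diag_op e x v) = diag_op e (\<lambda>n. d n - x n)" for x
    using assms(4) by (simp add: cond_exp_def diagonal_def[abs_def] diag_op_basis[OF e]
        cinner_diff_left cinner_scaleC_left basis_orthonormal[OF e])
  have tc: "trace_class e (cond_exp e (\<lambda>v. N v - diag_op e x v)) \<longleftrightarrow>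
      summable (\<lambda>n. cmod (d n - x n))" if "bounded (range x)" for x
    unfolding ce using bounded_minus_comp[of d UNIV x] bd that
    by (intro trace_class_diag_op_iff[OF e]) auto
  have "\<exists>x. bounded (range x) \<and> spectrum (diag_op e x) \<subseteq> spectrum N \<and>
      trace_class e (cond_exp e (\<lambda>v. N v - diag_op e x v))"
    if "d \<in> Lim1 (spectrum N)"
  proof -
    \<comment> \<open>The distance is attained because a finite set is closed and the spectrum is
      nonempty; \<open>basis_nonzero\<close> supplies the nonzero vector for the latter.\<close>
    have "\<exists>s\<in>spectrum N. infdist (d n) (spectrum N) = dist (d n) s" for n
      using infdist_attains_inf[OF finite_imp_closed[OF assms(3)]
          spectrum_nonempty[OF N basis_nonzero[OF e]], of "d n"] by metis
    then obtain x where x: "\<And>n. x n \<in> spectrum N"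
      "\<And>n. infdist (d n) (spectrum N) = dist (d n) (x n)"
      by metis
    have sub: "range x \<subseteq> spectrum N" using x(1) by auto
    then have bx: "bounded (range x)"
      using assms(3) by (meson bounded_subset finite_imp_bounded)
    \<comment> \<open>Finiteness of the spectrum enters again: being closed, it also contains any
      limit points of the chosen entries.\<close>
    have "closure (range x) \<subseteq> spectrum N"
      using sub assms(3) by (simp add: closure_minimal finite_imp_closed)
    then have "spectrum (diag_op e x) \<subseteq> spectrum N"
      using spectrum_diag_op_subset_closure[OF e bx] by blast
    moreover have "summable (\<lambda>n. cmod (d n - x n))"
      using that by (simp add: Lim1_def x(2) dist_norm)
    ultimately show ?thesis
      using bx tc[OF bx] by blast
  qed
  moreover have "d \<in> Lim1 (spectrum N)"
    if "bounded (range x)" "spectrum (diag_op e x) \<subseteq> spectrum N"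
      "trace_class e (cond_exp e (\<lambda>v. N v - diag_op e x v))" for x
  proof -
    have "x n \<in> spectrum N" for n
      using entry_in_spectrum_diag_op[OF e] that(2) by blast
    then have le: "norm (infdist (d n) (spectrum N)) \<le> cmod (d n - x n)" for n
      by (metis infdist_le dist_norm infdist_nonneg real_norm_def abs_of_nonneg)
    have "summable (\<lambda>n. cmod (d n - x n))"
      using that(1,3) tc by blast
    then have "summable (\<lambda>n. infdist (d n) (spectrum N))"
      by (rule summable_comparison_test') (rule le)
    then show ?thesis
      using bd by (simp add: Lim1_def)
  qed
  \<comment> \<open>Trace class means absolute summability of \<open>d n - x n\<close>, so the
    series defining \<open>op_trace\<close> converges and its \<open>suminf\<close> is the actual
    sum.\<close>
  moreover have "(\<lambda>n. d n - x n) sums op_trace e (cond_exp e (\<lambda>v. N v - diag_op e x v))"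
    if "bounded (range x)" "trace_class e (cond_exp e (\<lambda>v. N v - diag_op e x v))" for x
    using that tc summable_norm_cancel[of "\<lambda>n. d n - x n"]
    unfolding op_trace_def ce diagonal_diag_op[OF e] by (auto intro: summable_sums)
  ultimately show ?thesis by blast
qed

end
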